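(* Let $\widetilde v_j$ and $\widetilde w_j$ ($j=1,\dots,r$) be inexact solutions of $K(\sigma_j)v=B(\sigma_j)b_j$ and $K(\sigma_j)^Tw=C(\sigma_j)^Tc_j$ obtained in a Petrov-Galerkin framework (see context), with $\widetilde V_r=[\widetilde v_1,\dots,\widetilde v_r]$, $\widetilde W_r=[\widetilde w_1,\dots,\widetilde w_r]$, residuals $\eta_j=K(\sigma_j)\widetilde v_j-B(\sigma_j)b_j$, $\xi_j=K(\sigma_j)^T\widetilde w_j-C(\sigma_j)^Tc_j$, and residual matrices $R_b=[\eta_1,\dots,\eta_r]$, $R_c=[\xi_1,\dots,\xi_r]$. Assume $\widetilde W_r^T\widetilde V_r$ is nonsingular and define the oblique projector $\widetilde\Phi_r=\widetilde V_r(\widetilde W_r^T\widetilde V_r)^{-1}\widetilde W_r^T$. Then the matrix $$F_{2r}=R_b(\widetilde W_r^T\widetilde V_r)^{-1}\widetilde W_r^T+\widetilde V_r(\widetilde W_r^T\widetilde V_r)^{-1}R_c^T$$ satisfies $$\|F_{2r}\|_F\le\sqrt r\,\|\widetilde\Phi_r\|\left(\max_i\frac{\|\eta_i\|}{\|\widetilde v_i\|}\,\varsigma_{\min}(\widetilde V_rD_v)^{-1}+\max_i\frac{\|\xi_i\|}{\|\widetilde w_i\|}\,\varsigma_{\min}(\widetilde W_rD_w)^{-1}\right),$$ where $D_v=\mathrm{diag}(1/\|\widetilde v_1\|,\dots,1/\|\widetilde v_r\|)$ and $D_w=\mathrm{diag}(1/\|\widetilde w_1\|,\dots,1/\|\widetilde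 w_r\|)$.
   Context: $K(s)\in\mathbb{C}^{n\times n}$, $B(s)\in\mathbb{C}^{n\times m}$, $C(s)\in\mathbb{C}^{p\times n}$ are matrix-valued functions of $s$; $\sigma_j\in\mathbb{C}$ with $K(\sigma_j)$ nonsingular; $b_j\in\mathbb{C}^m$, $c_j\in\mathbb{C}^p$. $^T$ is transpose without conjugation. $\|\cdot\|$ is the Euclidean / spectral norm, $\|\cdot\|_F$ the Frobenius norm, $\varsigma_{\min}$ the smallest singular value. Petrov-Galerkin framework: $\mathcal P_N$ and $\mathcal Q_N$ are $N$-dimensional subspaces of $\mathbb{C}^n$ satisfying $(K(\sigma_j)\mathcal P_N)^\perp\cap\mathcal Q_N=\{0\}$ for all $j$; $\widetilde v_j\in\mathcal P_N$ is determined by $K(\sigma_j)\widetilde v_j-B(\sigma_j)b_j\perp\mathcal Q_N$, and $\widetilde w_j\in\mathcal Q_N$ by $K(\sigma_j)^T\widetilde w_j-C(\sigma_j)^Tc_j\perp\mathcal P_N$. Here $\perp$ is with respect to the bilinear pairing $x^Ty$ (no conjugation). *)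

theory Defs
  imports "HOL-Analysis.Analysis"
begin

(* Conventions: a matrix with 'a rows and 'b columns has type complex^'b^'a.  On complex^'n the
   library constant norm is the Euclidean norm, so onorm (\<lambda>x. A *v x) is the spectral norm of A.
   Complex subspaces and dimensions are vec.subspace and vec.dim; the unqualified subspace and dim
   of HOL-Analysis are the real ones. *)

text \<open>The library's \<open>scalar_product x y\<close> is the pairing \<open>x\<^sup>T y\<close>, without conjugation.\<close>

definition bilin_perp :: "(complex^'n) set \<Rightarrow> (complex^'n) set" where
  "bilin_perp S = {x. \<forall>y\<in>S. scalar_product x y = 0}"

definition mat_of_cols :: "('r \<Rightarrow> complex^'n) \<Rightarrow> complex^'r^'n" where
  "mat_of_cols f = (\<chi> i j. f j $ i)"

definition diag_mat :: "('r \<Rightarrow> complex) \<Rightarrow> complex^'r^'r" where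
  "diag_mat d = (\<chi> i j. if i = j then d i else 0)"

definition frobenius_norm :: "complex^'c^'r \<Rightarrow> real" where
  "frobenius_norm A = sqrt (\<Sum>i\<in>UNIV. \<Sum>j\<in>UNIV. (cmod (A $ i $ j))\<^sup>2)"

definition conj_transpose :: "complex^'c^'r \<Rightarrow> complex^'r^'c" where
  "conj_transpose A = (\<chi> i j. cnj (A $ j $ i))"

definition mat_eigenvalue :: "complex^'n^'n \<Rightarrow> complex \<Rightarrow> bool" where
  "mat_eigenvalue M l \<longleftrightarrow> (\<exists>x. x \<noteq> 0 \<and> M *v x = l *s x)"

text \<open>
  The singular values are the nonnegative square roots of the eigenvalues of the smaller of the two
  Gram matrices; the larger one has additional zero eigenvalues when the matrix is not square.
\<close>

definition singular_values :: "complex^'c^'r \<Rightarrow> real set" where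
  "singular_values A =
     (if CARD('c) \<le> CARD('r)
      then {s. 0 \<le> s \<and> mat_eigenvalue (conj_transpose A ** A) (complex_of_real (s\<^sup>2))}
      else {s. 0 \<le> s \<and> mat_eigenvalue (A ** conj_transpose A) (complex_of_real (s\<^sup>2))})"

definition min_singular_value :: "complex^'c^'r \<Rightarrow> real" where
  "min_singular_value A = Min (singular_values A)"

end

theory Submission
  imports Defs
begin

text \<open>
  Put \<open>L = (W\<^sup>T V)\<^sup>-\<^sup>1 W\<^sup>T\<close>, so that \<open>V L = \<Phi>\<close>. Then \<open>R\<^sub>b L = (R\<^sub>b D\<^sub>v) (D\<^sub>v\<^sup>-\<^sup>1 L)\<close>, where the first factor
  has columns \<open>\<eta>\<^sub>j / \<parallel>v\<^sub>j\<parallel>\<close>. Since \<open>(V D\<^sub>v) (D\<^sub>v\<^sup>-\<^sup>1 L) = \<Phi>\<close> and \<open>V D\<^sub>v\<close> stretches every vector by at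
  least its smallest singular value, the spectral norm of the second factor is at most
  \<open>\<parallel>\<Phi>\<parallel>\<close> divided by that singular value. The other summand of \<open>F\<close> is the transpose of a
  matrix of the same shape, with the roles of \<open>V\<close> and \<open>W\<close> exchanged and \<open>\<Phi>\<close> transposed.
\<close>

section \<open>Adjoints, transposes and spectral norms\<close>

text \<open>
  Here and below \<open>\<bullet>\<close> is the library's real inner product on \<open>complex^'n\<close>, that is, the real part
  of the Hermitian one; it suffices for the spectral arguments.
\<close>

lemma inner_conj_transpose:
  fixes A :: "complex^'c^'r"
  shows "(A *v x) \<bullet> y = x \<bullet> (conj_transpose A *v y)"
proof -
  have inner: "a \<bullet> b = Re (a * cnj b)" for a b :: complex
    by (simp add: inner_complex_def)
  have "(A *v x) \<bullet> y = (\<Sum>i\<in>UNIV. \<Sum>j\<in>UNIV. Re (A $ i $ j * x $ j * cnj (y $ i)))"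
    unfolding inner_vec_def matrix_vector_mult_def inner
    by (simp add: sum_distrib_right del: complex_cnj_mult times_complex.sel)
  also have "\<dots> = (\<Sum>j\<in>UNIV. \<Sum>i\<in>UNIV. Re (A $ i $ j * x $ j * cnj (y $ i)))"
    by (rule sum.swap)
  also have "\<dots> = x \<bullet> (conj_transpose A *v y)"
    unfolding inner_vec_def matrix_vector_mult_def inner conj_transpose_def
    by (simp add: sum_distrib_left mult_ac del: times_complex.sel)
  finally show ?thesis .
qed

lemma scaleR_eq_vector_scalar_mult:
  fixes x :: "complex^'n"
  shows "complex_of_real a *s x = a *\<^sub>R x"
  by (simp add: vec_eq_iff) (simp add: scaleR_conv_of_real)

lemma matrix_vector_mult_scaleR_complex:
  fixes A :: "complex^'c^'r"
  shows "A *v (a *\<^sub>R x) = a *\<^sub>R (A *v x)"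
  by (simp add: vec.scale flip: scaleR_eq_vector_scalar_mult)

lemma bounded_linear_complex_matrix:
  fixes A :: "complex^'c^'r"
  shows "bounded_linear (\<lambda>x. A *v x)"
  by (rule linear_conv_bounded_linear[THEN iffD1])
     (rule linearI, auto simp: matrix_vector_right_distrib matrix_vector_mult_scaleR_complex)

text \<open>With \<open>u = conj_transpose A *v z\<close>, moving the adjoint across the inner
  product turns the square of \<open>norm u\<close> into the inner product of \<open>A *v u\<close>
  with \<open>z\<close>. Cauchy-Schwarz applies, and one factor \<open>norm u\<close>
  cancels.\<close>

lemma norm_conj_transpose_mult_le:
  fixes A :: "complex^'c^'r"
  shows "norm (conj_transpose A *v z) \<le> onorm (\<lambda>x. A *v x) * norm z"
proof (cases "conj_transpose A *v z = 0")
  case True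
  then show ?thesis
    by (simp add: onorm_pos_le[OF bounded_linear_complex_matrix])
next
  case False
  let ?u = "conj_transpose A *v z"
  have "norm ?u * norm ?u = (A *v ?u) \<bullet> z"
    by (simp add: inner_conj_transpose dot_square_norm power2_eq_square)
  also have "\<dots> \<le> norm (A *v ?u) * norm z"
    by (rule norm_cauchy_schwarz)
  also have "\<dots> \<le> (onorm (\<lambda>x. A *v x) * norm ?u) * norm z"
    by (intro mult_right_mono onorm[OF bounded_linear_complex_matrix]) auto
  finally show ?thesis
    using False by (simp add: mult.assoc mult.left_commute[of _ "norm ?u"])
qed

text \<open>Transpose and adjoint differ only by entrywise conjugation of the argument and of the
  result, which preserves norms.\<close>

lemma norm_transpose_mult_le:
  fixes A :: "complex^'c^'r"
  shows "norm (transpose A *v z) \<le> onorm (\<lambda>x. A *v x) * norm z"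
proof -
  let ?z = "\<chi> i. cnj (z $ i)"
  have "(transpose A *v z) $ i = cnj ((conj_transpose A *v ?z) $ i)" for i
    by (simp add: matrix_vector_mult_def transpose_def conj_transpose_def)
  then have "norm (transpose A *v z) = norm (conj_transpose A *v ?z)"
    by (simp add: norm_vec_def)
  also have "\<dots> \<le> onorm (\<lambda>x. A *v x) * norm ?z"
    by (rule norm_conj_transpose_mult_le)
  also have "norm ?z = norm z"
    by (simp add: norm_vec_def)
  finally show ?thesis .
qed

lemma onorm_transpose_le:
  fixes A :: "complex^'c^'r"
  shows "onorm (\<lambda>x. transpose A *v x) \<le> onorm (\<lambda>x. A *v x)"
  by (rule onorm_le) (rule norm_transpose_mult_le)

lemma onorm_transpose:
  fixes A :: "complex^'c^'r"
  shows "onorm (\<lambda>x. transpose A *v x) = onorm (\<lambda>x. A *v x)"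
  using onorm_transpose_le[of A] onorm_transpose_le[of "transpose A"] by simp

section \<open>The Frobenius norm\<close>

lemma frobenius_norm_eq_rows:
  "frobenius_norm A = sqrt (\<Sum>i\<in>UNIV. (norm (A $ i))\<^sup>2)"
  by (simp add: frobenius_norm_def norm_vec_def L2_set_def sum_nonneg)

text \<open>This identification supplies the triangle inequality for the sum of two
  matrices.\<close>

lemma frobenius_norm_eq_norm: "frobenius_norm A = norm A"
  by (simp add: frobenius_norm_eq_rows norm_vec_def[of A] L2_set_def)

lemma frobenius_norm_transpose: "frobenius_norm (transpose A) = frobenius_norm A"
  unfolding frobenius_norm_def transpose_def by simp (rule sum.swap)

lemma frobenius_norm_mat_of_cols:
  "frobenius_norm (mat_of_cols f) = sqrt (\<Sum>j\<in>UNIV. (norm (f j))\<^sup>2)"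
proof -
  have "transpose (mat_of_cols f) $ j = f j" for j
    by (simp add: vec_eq_iff transpose_def mat_of_cols_def)
  then show ?thesis
    using frobenius_norm_eq_rows[of "transpose (mat_of_cols f)"]
    by (simp add: frobenius_norm_transpose)
qed

text \<open>Each row of \<open>G ** H\<close> is \<open>transpose H\<close> applied to the
  corresponding row of \<open>G\<close>, so the spectral bound acts row by row.\<close>

lemma frobenius_norm_mult_le:
  fixes G :: "complex^'k^'r" and H :: "complex^'c^'k"
  shows "frobenius_norm (G ** H) \<le> frobenius_norm G * onorm (\<lambda>x. H *v x)"
proof -
  let ?c = "onorm (\<lambda>x. H *v x)"
  have c: "0 \<le> ?c"
    by (rule onorm_pos_le[OF bounded_linear_complex_matrix])
  have "(G ** H) $ i = transpose H *v (G $ i)" for i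
    by (simp add: vec_eq_iff matrix_matrix_mult_def matrix_vector_mult_def transpose_def mult.commute)
  then have "norm ((G ** H) $ i) \<le> ?c * norm (G $ i)" for i
    by (simp only: norm_transpose_mult_le)
  then have "(\<Sum>i\<in>UNIV. (norm ((G ** H) $ i))\<^sup>2) \<le> (\<Sum>i\<in>UNIV. (?c * norm (G $ i))\<^sup>2)"
    by (intro sum_mono power_mono) auto
  also have "\<dots> = ?c\<^sup>2 * (\<Sum>i\<in>UNIV. (norm (G $ i))\<^sup>2)"
    by (simp add: power_mult_distrib sum_distrib_left)
  finally show ?thesis
    using c unfolding frobenius_norm_eq_rows
    by (intro real_le_lsqrt) (simp_all add: sum_nonneg power_mult_distrib mult.commute)
qed

section \<open>The smallest singular value\<close>

text \<open>Finiteness makes the \<open>Min\<close> in \<open>min_singular_value\<close> meaningful.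
  The Gram matrix is symmetric for the real inner product, so eigenvectors chosen for distinct
  \<open>s\<close> are orthogonal, hence independent over the reals in a finite-dimensional
  space.\<close>

lemma finite_real_eigenvalues_gram:
  fixes A :: "complex^'c^'r"
  shows "finite {s. 0 \<le> s \<and> mat_eigenvalue (conj_transpose A ** A) (complex_of_real (s\<^sup>2))}"
    (is "finite ?S")
proof -
  let ?M = "conj_transpose A ** A"
  have "\<forall>s\<in>?S. \<exists>x. x \<noteq> 0 \<and> ?M *v x = s\<^sup>2 *\<^sub>R x"
    unfolding mat_eigenvalue_def scaleR_eq_vector_scalar_mult by blast
  from bchoice[OF this] obtain e where e0: "\<And>s. s \<in> ?S \<Longrightarrow> e s \<noteq> 0"
    and e: "\<And>s. s \<in> ?S \<Longrightarrow> ?M *v e s = s\<^sup>2 *\<^sub>R e s"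
    by blast
  have gram: "(?M *v x) \<bullet> y = (A *v x) \<bullet> (A *v y)" for x y
    by (metis inner_commute inner_conj_transpose matrix_vector_mul_assoc)
  have orth: "e s \<bullet> e t = 0" if "s \<in> ?S" "t \<in> ?S" "s \<noteq> t" for s t
  proof -
    have "(?M *v e s) \<bullet> e t = (?M *v e t) \<bullet> e s"
      unfolding gram by (rule inner_commute)
    then have "s\<^sup>2 * (e s \<bullet> e t) = t\<^sup>2 * (e s \<bullet> e t)"
      unfolding e[OF that(1)] e[OF that(2)] by (simp add: inner_commute[of "e t"])
    moreover have "s\<^sup>2 \<noteq> t\<^sup>2"
      using that by (simp add: power2_eq_iff_nonneg)
    ultimately show ?thesis by simp
  qed
  have inj: "inj_on e ?S"
  proof (rule inj_onI, rule ccontr)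
    fix s t assume "s \<in> ?S" "t \<in> ?S" "e s = e t" "s \<noteq> t"
    with orth[of s t] e0[of s] show False by simp
  qed
  have "pairwise orthogonal (e ` ?S)"
    unfolding pairwise_def orthogonal_def using orth by blast
  moreover have "0 \<notin> e ` ?S"
  proof
    assume "0 \<in> e ` ?S"
    then obtain s where "s \<in> ?S" "0 = e s" by (rule imageE)
    with e0[of s] show False by simp
  qed
  ultimately have "independent (e ` ?S)"
    by (rule pairwise_orthogonal_independent)
  then have "finite (e ` ?S)"
    by (rule independent_imp_finite)
  then show ?thesis
    using inj by (rule finite_imageD)
qed

text \<open>The continuous map \<open>\<lambda>x. norm (A *v x)\<close> attains its minimum on the
  compact unit sphere. By homogeneity this minimum is the stretching constant \<open>s\<close>, and
  stationarity makes the minimiser an eigenvector of the Gram matrix for the squared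
  minimum.\<close>

lemma exists_minimal_singular_value:
  fixes A :: "complex^'c^'r"
  obtains s where "0 \<le> s" "mat_eigenvalue (conj_transpose A ** A) (complex_of_real (s\<^sup>2))"
    "\<And>y. s * norm y \<le> norm (A *v y)"
proof -
  let ?f = "\<lambda>x. norm (A *v x)"
  have "continuous_on (sphere 0 1) ?f"
    by (intro continuous_on_norm linear_continuous_on bounded_linear_complex_matrix)
  moreover have "sphere (0::complex^'c) 1 \<noteq> {}"
    by simp
  ultimately obtain x where x: "norm x = 1" and min: "\<And>y. norm y = 1 \<Longrightarrow> ?f x \<le> ?f y"
    using continuous_attains_inf[of "sphere 0 1" ?f] by auto
  have bound: "?f x * norm y \<le> ?f y" for y
  proof (cases "y = 0")
    case False
    then have "?f x \<le> ?f ((1 / norm y) *\<^sub>R y)"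
      by (intro min) simp
    then show ?thesis
      using False by (simp only: matrix_vector_mult_scaleR_complex) (simp add: field_simps)
  qed simp
  let ?g = "conj_transpose A *v (A *v x) - (?f x)\<^sup>2 *\<^sub>R x"
  have "?g \<bullet> z = 0" for z
  proof (rule ccontr)
    \<comment> \<open>the quadratic \<open>t \<mapsto> \<parallel>A(x + tz)\<parallel>\<^sup>2 - \<parallel>Ax\<parallel>\<^sup>2 \<parallel>x + tz\<parallel>\<^sup>2\<close> is nonnegative and vanishes at \<open>0\<close>,
        so its linear coefficient is zero\<close>
    define p where "p = ?g \<bullet> z"
    define q where "q = (?f z)\<^sup>2 - (?f x)\<^sup>2 * (norm z)\<^sup>2"
    assume "?g \<bullet> z \<noteq> 0"
    then have p: "p \<noteq> 0" by (simp add: p_def)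
    have q: "0 \<le> q"
      using power_mono[OF bound[of z], of 2] by (simp add: q_def power_mult_distrib)
    have *: "0 \<le> 2 * t * p + t\<^sup>2 * q" for t
    proof -
      have "(?f x)\<^sup>2 * (norm (x + t *\<^sub>R z))\<^sup>2 \<le> (?f (x + t *\<^sub>R z))\<^sup>2"
        using power_mono[OF bound[of "x + t *\<^sub>R z"], of 2] by (simp add: power_mult_distrib)
      moreover have "(norm (x + t *\<^sub>R z))\<^sup>2 = 1 + 2 * t * (x \<bullet> z) + t\<^sup>2 * (norm z)\<^sup>2"
        using x unfolding norm_eq_1 power2_norm_eq_inner
        by (simp add: inner_simps inner_commute[of z x] power2_eq_square distrib_left)
      moreover have "(?f (x + t *\<^sub>R z))\<^sup>2
          = (?f x)\<^sup>2 + 2 * t * ((A *v x) \<bullet> (A *v z)) + t\<^sup>2 * (?f z)\<^sup>2"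
        unfolding power2_norm_eq_inner
        by (simp add: matrix_vector_right_distrib matrix_vector_mult_scaleR_complex
            inner_simps inner_commute[of "A *v z" "A *v x"] power2_eq_square distrib_left)
      moreover have "p = (A *v x) \<bullet> (A *v z) - (?f x)\<^sup>2 * (x \<bullet> z)"
        using inner_conj_transpose[of A z "A *v x"] by (simp add: p_def inner_simps inner_commute)
      ultimately show ?thesis
        unfolding q_def by (simp only:) (simp add: algebra_simps)
    qed
    \<comment> \<open>A \<open>t\<close> of sign opposite to \<open>p\<close> and small enough makes
      the quadratic negative. The \<open>+ 1\<close> keeps the denominator positive even when
      \<open>q = 0\<close>.\<close>
    have "2 * (- p / (q + 1)) * p + (- p / (q + 1))\<^sup>2 * q = - (p\<^sup>2 * (q + 2)) / (q + 1)\<^sup>2"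
      using q by (simp add: divide_simps power2_eq_square) (simp add: algebra_simps)
    also have "\<dots> < 0"
      using p q by simp
    finally show False
      using *[of "- p / (q + 1)"] by simp
  qed
  then have "?g = 0"
    using inner_eq_zero_iff by blast
  then have "(conj_transpose A ** A) *v x = complex_of_real ((?f x)\<^sup>2) *s x"
    unfolding scaleR_eq_vector_scalar_mult by (simp flip: matrix_vector_mul_assoc)
  with x have "mat_eigenvalue (conj_transpose A ** A) (complex_of_real ((?f x)\<^sup>2))"
    unfolding mat_eigenvalue_def by (metis norm_zero zero_neq_one)
  then show ?thesis
    using bound that by (metis norm_ge_zero)
qed

text \<open>Puts injective matrices into the first branch of \<open>singular_values\<close>, the one
  with \<open>conj_transpose A ** A\<close>. The argument compares complex dimensions of the range
  and the codomain.\<close>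

lemma injective_imp_card_le:
  fixes A :: "complex^'c^'r"
  assumes "inj ((*v) A)"
  shows "CARD('c) \<le> CARD('r)"
proof -
  have "vec.dim (range ((*v) A)) = CARD('c)"
    using assms vec.dim_image_eq[OF matrix_vector_mul_linear_gen, of A UNIV] by (simp add: card_cart_basis)
  then show ?thesis
    using vec.dim_subset[of "range ((*v) A)" UNIV] by (simp add: card_cart_basis)
qed

text \<open>The minimum of the singular values is at most the stretching constant just found, so it
  is a lower bound for stretching too. It is positive because a kernel vector of the Gram matrix is
  a kernel vector of \<open>A\<close>.\<close>

lemma
  fixes A :: "complex^'c^'r"
  assumes inj: "inj ((*v) A)"
  shows min_singular_value_pos: "0 < min_singular_value A"
    and min_singular_value_le: "min_singular_value A * norm y \<le> norm (A *v y)"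
proof -
  let ?S = "{s. 0 \<le> s \<and> mat_eigenvalue (conj_transpose A ** A) (complex_of_real (s\<^sup>2))}"
  have S: "min_singular_value A = Min ?S"
    using injective_imp_card_le[OF inj] by (simp add: min_singular_value_def singular_values_def)
  have fin: "finite ?S" by (rule finite_real_eigenvalues_gram)
  obtain s where s: "s \<in> ?S" and bound: "\<And>y. s * norm y \<le> norm (A *v y)"
    using exists_minimal_singular_value[of A] by blast
  have "Min ?S \<le> s"
    using fin s by (rule Min_le)
  then show "min_singular_value A * norm y \<le> norm (A *v y)"
    unfolding S by (meson bound mult_right_mono norm_ge_zero order_trans)
  have "0 \<notin> ?S"
  proof
    assume "0 \<in> ?S"
    then obtain x where x: "x \<noteq> 0" "conj_transpose A *v (A *v x) = 0"
      by (auto simp: mat_eigenvalue_def matrix_vector_mul_assoc)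
    then have "(A *v x) \<bullet> (A *v x) = 0"
      by (simp add: inner_conj_transpose)
    then have "A *v x = A *v 0" by simp
    with x inj show False by (blast dest: injD)
  qed
  moreover have "Min ?S \<in> ?S"
    using fin s Min_in by blast
  ultimately show "0 < min_singular_value A"
    unfolding S by (metis (mono_tags, lifting) mem_Collect_eq order_le_less)
qed

section \<open>Diagonal scaling and the bound for one summand\<close>

lemma mat_of_cols_mult_diag_mat:
  "mat_of_cols f ** diag_mat d = mat_of_cols (\<lambda>j. d j *s f j)"
  by (simp add: vec_eq_iff matrix_matrix_mult_def mat_of_cols_def diag_mat_def mult_delta_right mult.commute)

lemma diag_mat_mult_diag_mat: "diag_mat d ** diag_mat e = diag_mat (\<lambda>j. d j * e j)"
  by (simp add: vec_eq_iff matrix_matrix_mult_def diag_mat_def mult_delta_right)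

lemma diag_mat_one: "diag_mat (\<lambda>j. 1) = mat 1"
  by (simp add: diag_mat_def mat_def)

text \<open>Keeping \<open>L\<close> arbitrary lets both summands use this bound: the product of
  \<open>mat_of_cols v\<close> and \<open>L\<close> becomes \<open>\<Phi>\<close> in one case and
  \<open>transpose \<Phi>\<close> in the other.\<close>

lemma frobenius_norm_residual_le:
  fixes v \<eta> :: "'r::finite \<Rightarrow> complex^'n" and L :: "complex^'n^'r"
  assumes inj: "inj ((*v) (mat_of_cols v))"
  defines "D \<equiv> diag_mat (\<lambda>j. complex_of_real (1 / norm (v j)))"
  shows "frobenius_norm (mat_of_cols \<eta> ** L) \<le>
    sqrt (real CARD('r)) * onorm (\<lambda>x. (mat_of_cols v ** L) *v x) *
      ((MAX i. norm (\<eta> i) / norm (v i)) * inverse (min_singular_value (mat_of_cols v ** D)))"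
proof -
  let ?V = "mat_of_cols v" and ?m = "MAX i. norm (\<eta> i) / norm (v i)"
  let ?s = "min_singular_value (?V ** D)"
  define E where "E = diag_mat (\<lambda>j. complex_of_real (norm (v j)))"
  \<comment> \<open>Column \<open>j\<close> is the image of the unit vector \<open>axis j 1\<close>,
    so injectivity excludes a zero column. Otherwise \<open>1 / norm (v j)\<close> would be the
    default value \<open>0\<close> and \<open>D\<close> would be singular.\<close>
  have v0: "v j \<noteq> 0" for j
  proof
    assume "v j = 0"
    moreover have "?V *v axis j 1 = v j"
      by (simp add: matrix_vector_mult_def mat_of_cols_def axis_def vec_eq_iff if_distrib cong: if_cong)
    ultimately have "axis j (1::complex) = 0"
      by (intro injD[OF inj]) simp
    then show False
      by (simp add: axis_eq_0_iff)
  qed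
  have DE: "D ** E = mat 1" "E ** D = mat 1"
    using v0 by (simp_all add: D_def E_def diag_mat_mult_diag_mat diag_mat_one flip: of_real_mult)
  \<comment> \<open>A left inverse \<open>X\<close> of \<open>?V\<close> gives the left inverse
    \<open>E ** X\<close> of \<open>?V ** D\<close>, so scaling the columns keeps
    injectivity.\<close>
  obtain X where X: "X ** ?V = mat 1"
    using inj by (auto simp flip: matrix_left_invertible_injective)
  have "(E ** X) ** (?V ** D) = E ** ((X ** ?V) ** D)"
    by (simp only: matrix_mul_assoc)
  then have "(E ** X) ** (?V ** D) = mat 1"
    by (simp add: X DE)
  then have "inj ((*v) (?V ** D))"
    by (auto simp flip: matrix_left_invertible_injective)
  note s = min_singular_value_pos[OF this] min_singular_value_le[OF this]
  have "norm ((E ** L) *v x) \<le> onorm (\<lambda>x. (?V ** L) *v x) * inverse ?s * norm x" for x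
  proof -
    have "(?V ** D) ** (E ** L) = ?V ** ((D ** E) ** L)"
      by (simp only: matrix_mul_assoc)
    then have "(?V ** D) ** (E ** L) = ?V ** L"
      by (simp add: DE)
    then have "?s * norm ((E ** L) *v x) \<le> norm ((?V ** L) *v x)"
      using s(2)[of "(E ** L) *v x"] by (simp add: matrix_vector_mul_assoc)
    also have "\<dots> \<le> onorm (\<lambda>x. (?V ** L) *v x) * norm x"
      by (rule onorm[OF bounded_linear_complex_matrix])
    finally show ?thesis
      using s(1) by (simp add: field_simps)
  qed
  then have EL: "onorm (\<lambda>x. (E ** L) *v x) \<le> onorm (\<lambda>x. (?V ** L) *v x) * inverse ?s"
    by (rule onorm_le)
  have le_m: "norm (\<eta> i) / norm (v i) \<le> ?m" for i
    by (rule Max_ge) auto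
  have m: "0 \<le> ?m"
    using le_m by (meson divide_nonneg_nonneg norm_ge_zero order_trans)
  have "frobenius_norm (mat_of_cols \<eta> ** D) = sqrt (\<Sum>j\<in>UNIV. (norm (\<eta> j) / norm (v j))\<^sup>2)"
    unfolding D_def mat_of_cols_mult_diag_mat frobenius_norm_mat_of_cols scaleR_eq_vector_scalar_mult
    by simp
  \<comment> \<open>Bounding each of the \<open>CARD('r)\<close> columns by the largest ratio is the
    source of the factor \<open>sqrt (real CARD('r))\<close>.\<close>
  also have "\<dots> \<le> sqrt (\<Sum>j\<in>(UNIV::'r set). ?m\<^sup>2)"
    by (intro real_sqrt_le_mono sum_mono power_mono le_m) auto
  also have "\<dots> = sqrt (real CARD('r)) * ?m"
    using m by (simp add: real_sqrt_mult)
  finally have RD: "frobenius_norm (mat_of_cols \<eta> ** D) \<le> sqrt (real CARD('r)) * ?m" .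
  have "(mat_of_cols \<eta> ** D) ** (E ** L) = mat_of_cols \<eta> ** ((D ** E) ** L)"
    by (simp only: matrix_mul_assoc)
  then have "mat_of_cols \<eta> ** L = (mat_of_cols \<eta> ** D) ** (E ** L)"
    by (simp add: DE)
  then have "frobenius_norm (mat_of_cols \<eta> ** L)
      \<le> frobenius_norm (mat_of_cols \<eta> ** D) * onorm (\<lambda>x. (E ** L) *v x)"
    by (metis frobenius_norm_mult_le)
  also have "\<dots> \<le> (sqrt (real CARD('r)) * ?m) * (onorm (\<lambda>x. (?V ** L) *v x) * inverse ?s)"
    using m by (intro mult_mono RD EL onorm_pos_le bounded_linear_complex_matrix) auto
  finally show ?thesis
    by (simp add: mult_ac)
qed

section \<open>Injectivity of both bases and the final estimate\<close>

lemma invertible_mult_imp_injective: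
  fixes A :: "complex^'c^'r" and B :: "complex^'r^'c"
  assumes "invertible (B ** A)"
  shows "inj ((*v) A)"
proof -
  obtain C where "C ** (B ** A) = mat 1"
    using assms by (auto simp: invertible_def)
  then have "(C ** B) ** A = mat 1"
    by (simp only: matrix_mul_assoc)
  then show ?thesis
    by (auto simp flip: matrix_left_invertible_injective)
qed

lemma invertible_transpose_complex:
  fixes A :: "complex^'n^'n"
  assumes "invertible A"
  shows "invertible (transpose A)"
proof -
  obtain B where "A ** B = mat 1" "B ** A = mat 1"
    using assms by (auto simp: invertible_def)
  then have "transpose B ** transpose A = mat 1" "transpose A ** transpose B = mat 1"
    by (simp_all flip: matrix_transpose_mul)
  then show ?thesis
    unfolding invertible_def by blast
qed

theorem theorem4p2:
  fixes K :: "complex \<Rightarrow> complex^'n^'n"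
    and B :: "complex \<Rightarrow> complex^'m^'n"
    and C :: "complex \<Rightarrow> complex^'n^'p"
    and \<sigma> :: "'r::finite \<Rightarrow> complex"
    and b :: "'r \<Rightarrow> complex^'m"
    and c :: "'r \<Rightarrow> complex^'p"
    and P Q :: "(complex^'n) set"
    and N :: nat
    and v w \<eta> \<xi> :: "'r \<Rightarrow> complex^'n"
    and V W Rb Rc :: "complex^'r^'n"
    and Dv Dw :: "complex^'r^'r"
    and \<Phi> F :: "complex^'n^'n"
  assumes K_nonsing: "\<And>j. invertible (K (\<sigma> j))"
    and P_subspace: "vec.subspace P" and P_dim: "vec.dim P = N"
    and Q_subspace: "vec.subspace Q" and Q_dim: "vec.dim Q = N"
    and PQ: "\<And>j. bilin_perp ((\<lambda>x. K (\<sigma> j) *v x) ` P) \<inter> Q = {0}"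
    and \<eta>_eq: "\<And>j. \<eta> j = K (\<sigma> j) *v v j - B (\<sigma> j) *v b j"
    and \<xi>_eq: "\<And>j. \<xi> j = transpose (K (\<sigma> j)) *v w j - transpose (C (\<sigma> j)) *v c j"
    and v_in_P: "\<And>j. v j \<in> P" and v_galerkin: "\<And>j. \<eta> j \<in> bilin_perp Q"
    and w_in_Q: "\<And>j. w j \<in> Q" and w_galerkin: "\<And>j. \<xi> j \<in> bilin_perp P"
    and V_eq: "V = mat_of_cols v" and W_eq: "W = mat_of_cols w"
    and Rb_eq: "Rb = mat_of_cols \<eta>" and Rc_eq: "Rc = mat_of_cols \<xi>"
    and WV_nonsing: "invertible (transpose W ** V)"
    and \<Phi>_eq: "\<Phi> = V ** matrix_inv (transpose W ** V) ** transpose W"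
    and F_eq: "F = Rb ** matrix_inv (transpose W ** V) ** transpose W
                 + V ** matrix_inv (transpose W ** V) ** transpose Rc"
    and Dv_eq: "Dv = diag_mat (\<lambda>j. complex_of_real (1 / norm (v j)))"
    and Dw_eq: "Dw = diag_mat (\<lambda>j. complex_of_real (1 / norm (w j)))"
  shows "frobenius_norm F \<le> sqrt (real CARD('r)) * onorm (\<lambda>x. \<Phi> *v x) *
           ((MAX i. norm (\<eta> i) / norm (v i)) * inverse (min_singular_value (V ** Dv))
          + (MAX i. norm (\<xi> i) / norm (w i)) * inverse (min_singular_value (W ** Dw)))"
proof -
  let ?X = "matrix_inv (transpose W ** V)"
  let ?mv = "MAX i. norm (\<eta> i) / norm (v i)" and ?mw = "MAX i. norm (\<xi> i) / norm (w i)"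
  have "inj ((*v) (mat_of_cols v))"
    using invertible_mult_imp_injective[OF WV_nonsing] by (simp only: V_eq)
  from frobenius_norm_residual_le[where \<eta> = \<eta> and L = "?X ** transpose W", OF this]
  have first: "frobenius_norm (Rb ** ?X ** transpose W) \<le> sqrt (real CARD('r)) *
      onorm (\<lambda>x. \<Phi> *v x) * (?mv * inverse (min_singular_value (V ** Dv)))"
    by (simp add: Rb_eq V_eq Dv_eq \<Phi>_eq matrix_mul_assoc)
  \<comment> \<open>Transposing the nonsingular matrix exchanges \<open>V\<close> and
    \<open>W\<close>, so the columns of \<open>W\<close> are independent as well.\<close>
  have "invertible (transpose V ** W)"
    using invertible_transpose_complex[OF WV_nonsing] by (simp add: matrix_transpose_mul)
  from invertible_mult_imp_injective[OF this] have "inj ((*v) (mat_of_cols w))"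
    by (simp only: W_eq)
  from frobenius_norm_residual_le[where \<eta> = \<xi> and L = "transpose ?X ** transpose V", OF this]
  have "frobenius_norm (Rc ** (transpose ?X ** transpose V)) \<le> sqrt (real CARD('r)) *
      onorm (\<lambda>x. (W ** (transpose ?X ** transpose V)) *v x) * (?mw * inverse (min_singular_value (W ** Dw)))"
    by (simp add: Rc_eq W_eq Dw_eq)
  \<comment> \<open>The bound just obtained concerns the transpose of the second summand and
    \<open>transpose \<Phi>\<close>. Both norms are invariant under transposition, so it carries
    over.\<close>
  moreover have "Rc ** (transpose ?X ** transpose V) = transpose (V ** ?X ** transpose Rc)"
    by (simp add: matrix_transpose_mul)
  moreover have "W ** (transpose ?X ** transpose V) = transpose \<Phi>"
    by (simp add: \<Phi>_eq matrix_transpose_mul)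
  ultimately have second: "frobenius_norm (V ** ?X ** transpose Rc) \<le> sqrt (real CARD('r)) *
      onorm (\<lambda>x. \<Phi> *v x) * (?mw * inverse (min_singular_value (W ** Dw)))"
    by (simp only: frobenius_norm_transpose onorm_transpose)
  have "frobenius_norm F \<le> frobenius_norm (Rb ** ?X ** transpose W)
      + frobenius_norm (V ** ?X ** transpose Rc)"
    unfolding F_eq frobenius_norm_eq_norm by (rule norm_triangle_ineq)
  with first second show ?thesis
    by (simp add: distrib_left)
qed

end
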